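(* Let $\bar\kappa$ be a fixed positive integer. Let $\bar f\in\mathbb{R}_{++}$, $d\in[0,\bar f)$, and $\bar f_j=\kappa_j\bar f$ with $\kappa_j\in\{1,\dots,\bar\kappa\}$ for $j\in\{1,\dots,n\}$. Consider the set $$\mathcal{S}=\Big\{(x,f)\in\{0,1\}^n\times\mathbb{R}^{n+1}:\ \sum_{j=0}^n f_j=d,\ \ \underline f_j x_j\le f_j\le \bar f_j x_j,\ j\in\{0,1,\dots,n\}\Big\},$$ where $\underline f_j=-\bar f_j$ for $j\in\{1,\dots,n\}$, $x_0:=1$ and $\underline f_0=\bar f_0=0$. Then there exists a compact extended formulation for $\operatorname{conv}(\mathcal{S})$ whose size is polynomial in $n$ and $\bar\kappa$.
   Context: Coordinates: $x=(x_1,\dots,x_n)$ and $f=(f_0,f_1,\dots,f_n)$; $x_0$ is the constant $1$. An extended formulation of $\operatorname{conv}(\mathcal{S})$ is a system of linear equations and inequalities in variables $(x,f,Y)$, with additional real variables $Y$, such that the projection of its solution set onto the $(x,f)$-space equals $\operatorname{conv}(\mathcal{S})$. Its size is measured by the number of its variables and constraints. *)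

theory Defs
  imports
    "HOL-Analysis.Analysis"
    "HOL-Analysis.Finite_Function_Topology"
    "HOL-Computational_Algebra.Polynomial"
begin

text \<open>
  Since \<open>n\<close> varies inside the statement, a vector with coordinates indexed by a finite set of
  naturals is a finitely supported function \<open>nat \<Rightarrow>\<^sub>0 real\<close> whose support lies in that index
  set. This type is an instance of \<^class>\<open>real_vector\<close>, so the library's convex hull applies to
  sets of pairs \<open>(x, f)\<close>.
\<close>

type_synonym point = "(nat \<Rightarrow>\<^sub>0 real) \<times> (nat \<Rightarrow>\<^sub>0 real)"

definition xf_space :: "nat \<Rightarrow> point set" where
  "xf_space n = {(x, f). Poly_Mapping.keys x \<subseteq> {1..n} \<and> Poly_Mapping.keys f \<subseteq> {0..n}}"

text \<open>The coordinate \<open>x\<^sub>0\<close> is the constant 1, not a component of \<open>x\<close>.\<close>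

definition x_ext :: "(nat \<Rightarrow>\<^sub>0 real) \<Rightarrow> nat \<Rightarrow> real" where
  "x_ext x j = (if j = 0 then 1 else Poly_Mapping.lookup x j)"

definition flow_set :: "nat \<Rightarrow> real \<Rightarrow> (nat \<Rightarrow> real) \<Rightarrow> (nat \<Rightarrow> real) \<Rightarrow> point set" where
  "flow_set n d l u = {(x, f) \<in> xf_space n.
     (\<forall>j\<in>{1..n}. Poly_Mapping.lookup x j \<in> {0, 1}) \<and>
     (\<Sum>j = 0..n. Poly_Mapping.lookup f j) = d \<and>
     (\<forall>j\<in>{0..n}. l j * x_ext x j \<le> Poly_Mapping.lookup f j \<and>
                 Poly_Mapping.lookup f j \<le> u j * x_ext x j)}"

text \<open>
  A constraint consists of the coefficients of the \<open>x\<close>-, \<open>f\<close>- and \<open>Y\<close>-variables and a right-hand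
  side. With \<open>m\<close> additional variables, these are \<open>Y 0, \<dots>, Y (m - 1)\<close>; coefficients
  outside the relevant index ranges are ignored.
\<close>

datatype linear_constraint =
    Lin_Eq "nat \<Rightarrow> real" "nat \<Rightarrow> real" "nat \<Rightarrow> real" real
  | Lin_Le "nat \<Rightarrow> real" "nat \<Rightarrow> real" "nat \<Rightarrow> real" real

definition linear_form ::
  "nat \<Rightarrow> nat \<Rightarrow> (nat \<Rightarrow> real) \<Rightarrow> (nat \<Rightarrow> real) \<Rightarrow> (nat \<Rightarrow> real) \<Rightarrow> point \<Rightarrow> (nat \<Rightarrow> real) \<Rightarrow> real" where
  "linear_form n m a b c z Y =
     (\<Sum>j = 1..n. a j * Poly_Mapping.lookup (fst z) j) +
     (\<Sum>j = 0..n. b j * Poly_Mapping.lookup (snd z) j) +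
     (\<Sum>k < m. c k * Y k)"

fun satisfies :: "nat \<Rightarrow> nat \<Rightarrow> point \<Rightarrow> (nat \<Rightarrow> real) \<Rightarrow> linear_constraint \<Rightarrow> bool" where
  "satisfies n m z Y (Lin_Eq a b c r) \<longleftrightarrow> linear_form n m a b c z Y = r"
| "satisfies n m z Y (Lin_Le a b c r) \<longleftrightarrow> linear_form n m a b c z Y \<le> r"

definition extended_formulation ::
  "nat \<Rightarrow> nat \<Rightarrow> linear_constraint list \<Rightarrow> point set \<Rightarrow> bool" where
  "extended_formulation n m cs P \<longleftrightarrow>
     {z \<in> xf_space n. \<exists>Y. \<forall>c \<in> set cs. satisfies n m z Y c} = P"

definition formulation_size :: "nat \<Rightarrow> nat \<Rightarrow> linear_constraint list \<Rightarrow> nat" where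
  "formulation_size n m cs = (n + (n + 1) + m) + length cs"

text \<open>A polynomial in two variables is evaluated at \<open>(a, b)\<close> by substituting \<open>a\<close> for the outer
  variable and \<open>b\<close> for the variable of the coefficients.\<close>

definition poly_eval2 :: "nat poly poly \<Rightarrow> nat \<Rightarrow> nat \<Rightarrow> nat" where
  "poly_eval2 p a b = poly (poly p [:a:]) b"

end

theory Submission
  imports Defs
begin

text \<open>
  A feasible point is a walk of partial sums \<open>f\<^sub>0 + \<dots> + f\<^sub>j\<close> from 0 to \<open>d\<close> with steps \<open>f\<^sub>j\<close>, where \<open>\<bar>f\<^sub>j\<bar> \<le> \<kappa>\<^sub>j f\<close>
  if \<open>x\<^sub>j = 1\<close> and \<open>f\<^sub>j = 0\<close> if \<open>x\<^sub>j = 0\<close>. (Here and below, \<open>f\<close> without index is the base capacity.)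
  The extended formulation rests on the fact that the convex
  hull is already generated by the walks whose partial sums lie in the grid of the numbers \<open>k f\<close>
  and \<open>k f + d\<close> with \<open>\<bar>k\<bar> \<le> n \<kappa>\<close>, where \<open>\<kappa>\<close> bounds the \<open>\<kappa>\<^sub>j\<close>. There are only \<open>O(n \<kappa>)\<close> such numbers. Such walks are
  exactly the paths from \<open>(0, 0)\<close> to \<open>(n, d)\<close> in a layered network whose nodes are pairs of a stage and a
  grid point, and the convex hull of the paths of an acyclic network is described by the flow
  conservation equations, one variable per arc.

  That grid walks suffice is shown by randomised rounding (\<open>rounded_flow_average\<close>) instead of an
  analysis of vertices. For a threshold \<open>\<theta>\<close>, the map \<open>stair\<close> moves every number to a
  neighbouring grid point. It is monotone and commutes with shifts by \<open>f\<close>, so a bound \<open>\<kappa>\<^sub>j f\<close> on the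
  distance of consecutive partial sums survives; it fixes the end points 0 and \<open>d\<close> as these are grid
  points; and averaging over \<open>\<theta>\<close> gives back the original number.

  Conversely, a flow is a convex combination of points of the set (\<open>layered_flow_decomposition\<close>,
  \<open>path_flow_imp_convex_hull\<close>), by induction over the stages, because
  every arc extends feasible points to feasible points of the next stage. With \<open>4 n \<kappa> + 2\<close> grid points at most,
  the numbers of arcs and of conservation equations are polynomial in \<open>n\<close> and \<open>\<kappa>\<close>.
\<close>

section \<open>Rounding to a grid without changing averages\<close>

lemma nonneg_threshold_weights:
  fixes V :: "real set"
  assumes "finite V" "V \<subseteq> {0..}"
  shows "\<exists>\<Theta> w. finite \<Theta> \<and> \<Theta> \<subseteq> {0..} \<and> (\<forall>\<theta>\<in>\<Theta>. 0 \<le> w \<theta>) \<and>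
           (\<forall>v\<in>V. (\<Sum>\<theta>\<in>{\<theta>\<in>\<Theta>. \<theta> < v}. w \<theta>) = (v :: real))"
  using assms
proof (induction V rule: finite_linorder_max_induct)
  case empty
  show ?case by (rule exI[of _ "{}"]) auto
next
  case (insert b V)
  then obtain \<Theta> w where IH: "finite \<Theta>" "\<Theta> \<subseteq> {0..}" "\<forall>\<theta>\<in>\<Theta>. 0 \<le> w \<theta>"
    "\<forall>v\<in>V. (\<Sum>\<theta>\<in>{\<theta>\<in>\<Theta>. \<theta> < v}. w \<theta>) = v" by auto
  \<comment> \<open>The new value \<open>b\<close> is the largest. Thresholds from \<open>M\<close> on are invisible to \<open>V\<close>;
      they are discarded and replaced by a single threshold at \<open>M\<close> that carries the gap \<open>b - M\<close>.\<close>
  define M where "M = Max (insert 0 V)"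
  have M0: "0 \<le> M" and MV: "\<And>v. v \<in> V \<Longrightarrow> v \<le> M"
    using insert.hyps unfolding M_def by auto
  have Mmem: "M = 0 \<or> M \<in> V"
    using Max_in[of "insert 0 V"] insert.hyps unfolding M_def by auto
  have b: "0 \<le> b" "M \<le> b" using insert Mmem by auto
  define \<Theta>' where "\<Theta>' = insert M {\<theta>\<in>\<Theta>. \<theta> < M}"
  define w' where "w' = w(M := b - M)"
  have low: "(\<Sum>\<theta>\<in>{\<theta>\<in>\<Theta>. \<theta> < M}. w \<theta>) = M"
  proof (cases "M \<in> V")
    case False
    then have "M = 0" using Mmem by auto
    moreover have "{\<theta>\<in>\<Theta>. \<theta> < 0} = {}" using IH(2) by force
    ultimately show ?thesis by (simp only: sum.empty)
  qed (use IH in auto)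
  have same: "(\<Sum>\<theta>\<in>{\<theta>\<in>\<Theta>. \<theta> < v}. w' \<theta>) = (\<Sum>\<theta>\<in>{\<theta>\<in>\<Theta>. \<theta> < v}. w \<theta>)" if "v \<le> M" for v
    by (rule sum.cong) (use that in \<open>auto simp: w'_def\<close>)
  have old: "(\<Sum>\<theta>\<in>{\<theta>\<in>\<Theta>'. \<theta> < v}. w' \<theta>) = v" if "v \<in> V" for v
  proof -
    have "{\<theta>\<in>\<Theta>'. \<theta> < v} = {\<theta>\<in>\<Theta>. \<theta> < v}" using MV[OF that] by (auto simp: \<Theta>'_def)
    then show ?thesis using same[OF MV[OF that]] IH(4) that by auto
  qed
  have new: "(\<Sum>\<theta>\<in>{\<theta>\<in>\<Theta>'. \<theta> < b}. w' \<theta>) = b"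
  proof (cases "M < b")
    case True
    then have "{\<theta>\<in>\<Theta>'. \<theta> < b} = insert M {\<theta>\<in>\<Theta>. \<theta> < M}" by (auto simp: \<Theta>'_def)
    then have "(\<Sum>\<theta>\<in>{\<theta>\<in>\<Theta>'. \<theta> < b}. w' \<theta>) = w' M + (\<Sum>\<theta>\<in>{\<theta>\<in>\<Theta>. \<theta> < M}. w' \<theta>)"
      using IH(1) by simp
    then show ?thesis using same[of M] low by (simp add: w'_def)
  next
    case False
    then have "b = M" using b by auto
    then have "b = 0" using Mmem insert.hyps by auto
    moreover have "{\<theta>\<in>\<Theta>'. \<theta> < 0} = {}" using IH(2) M0 by (force simp: \<Theta>'_def)
    ultimately show ?thesis by (simp only: sum.empty)
  qed
  show ?case
    by (rule exI[of _ \<Theta>'], rule exI[of _ w'])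
       (use IH M0 b old new in \<open>auto simp: \<Theta>'_def w'_def\<close>)
qed

text \<open>
  A finite substitute for a uniformly distributed threshold: a random \<open>\<theta>\<close> in \<open>[0, 1)\<close> that falls below \<open>v\<close>
  with probability exactly \<open>v\<close>, for the finitely many \<open>v\<close> that matter. The finite support
  makes the resulting averages finite convex combinations. The weight 1 in total comes from adding
  the value 1 to \<open>V\<close>.
\<close>

lemma threshold_weights:
  fixes V :: "real set"
  assumes "finite V" "V \<subseteq> {0..1}"
  obtains \<Theta> w where "finite \<Theta>" "\<Theta> \<subseteq> {0..<1}" "\<And>\<theta>. \<theta> \<in> \<Theta> \<Longrightarrow> 0 \<le> w \<theta>" "sum w \<Theta> = 1"
    "\<And>v. v \<in> V \<Longrightarrow> (\<Sum>\<theta>\<in>{\<theta>\<in>\<Theta>. \<theta> < v}. w \<theta>) = (v :: real)"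
proof -
  obtain \<Theta> w where *: "finite \<Theta>" "\<Theta> \<subseteq> {0..}" "\<forall>\<theta>\<in>\<Theta>. 0 \<le> w \<theta>"
    "\<forall>v\<in>insert 1 V. (\<Sum>\<theta>\<in>{\<theta>\<in>\<Theta>. \<theta> < v}. w \<theta>) = (v :: real)"
  proof -
    have "finite (insert 1 V)" "insert 1 V \<subseteq> {0..}" using assms by auto
    from nonneg_threshold_weights[OF this] show thesis using that by blast
  qed
  have "{\<theta>\<in>{\<theta>\<in>\<Theta>. \<theta> < 1}. \<theta> < v} = {\<theta>\<in>\<Theta>. \<theta> < v}" if "v \<in> V" for v
    using assms(2) that by force
  then show thesis
    using * by (intro that[of "{\<theta>\<in>\<Theta>. \<theta> < 1}" w]) auto
qed

text \<open>
  Rounding of \<open>s\<close> to the grid \<open>f\<int> \<union> (d + f\<int>)\<close>: every cell of the grid, \<open>[k f, k f + d]\<close> or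
  \<open>[k f + d, (k + 1) f]\<close>, is cut at the same relative position \<open>\<theta>\<close>, and \<open>s\<close> moves to the lower or upper
  end of its cell according to the side of the cut. The two ceilings count, with sign, the cuts of each
  kind between 0 and \<open>s\<close>, and crossing a cut raises the value by the length of its cell. In this form,
  monotonicity and compatibility with shifts by \<open>f\<close> are immediate.
\<close>

definition stair :: "real \<Rightarrow> real \<Rightarrow> real \<Rightarrow> real \<Rightarrow> real" where
  "stair f d \<theta> s = d * of_int \<lceil>(s - \<theta> * d) / f\<rceil> + (f - d) * of_int \<lceil>(s - (d + \<theta> * (f - d))) / f\<rceil>"

definition grid :: "real \<Rightarrow> real \<Rightarrow> nat \<Rightarrow> real set" where
  "grid f d N = (\<lambda>(k, c). of_int k * f + c) ` ({- int N..int N} \<times> {0, d})"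

lemma finite_grid: "finite (grid f d N)"
  by (simp add: grid_def)

lemma card_grid: "card (grid f d N) \<le> 4 * N + 2"
proof -
  have "card (grid f d N) \<le> card ({- int N..int N} \<times> {0, d})"
    unfolding grid_def by (rule card_image_le) simp
  also have "\<dots> = (2 * N + 1) * card {0, d}"
    by (simp only: card_cartesian_product card_atLeastAtMost_int) (simp add: nat_add_distrib nat_mult_distrib)
  also have "\<dots> \<le> (2 * N + 1) * 2" by (intro mult_le_mono2) (simp add: card_insert_if)
  finally show ?thesis by simp
qed

lemma zero_mem_grid: "0 \<in> grid f d N" and d_mem_grid: "d \<in> grid f d N"
  unfolding grid_def by (rule image_eqI[of _ _ "(0, 0)"]; simp) (rule image_eqI[of _ _ "(0, d)"]; simp)

lemma stair_mono:
  assumes "0 \<le> d" "d < f" "s \<le> t"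
  shows "stair f d \<theta> s \<le> stair f d \<theta> t"
proof -
  have "\<lceil>(s - c) / f\<rceil> \<le> \<lceil>(t - c) / f\<rceil>" for c
    using assms by (intro ceiling_mono divide_right_mono) auto
  then show ?thesis
    unfolding stair_def using assms by (intro add_mono mult_left_mono) auto
qed

lemma stair_shift:
  assumes "0 < f"
  shows "stair f d \<theta> (s + of_int k * f) = stair f d \<theta> s + of_int k * f"
proof -
  have "(s + of_int k * f - c) / f = (s - c) / f + of_int k" for c
    using assms by (simp add: field_simps)
  then have "\<lceil>(s + of_int k * f - c) / f\<rceil> = \<lceil>(s - c) / f\<rceil> + k" for c
    by simp
  then show ?thesis unfolding stair_def by (simp only: of_int_add) (simp add: algebra_simps)
qed

text \<open>
  By monotonicity and compatibility with shifts, \<open>s \<le> t + k f\<close> gives the same inequality for the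
  rounded values. A distance bound that is not a multiple of \<open>f\<close> need not survive rounding; this is
  why the capacities have to be multiples of \<open>f\<close>.
\<close>

lemma stair_nonexpansive:
  assumes "0 \<le> d" "d < f" "\<bar>s - t\<bar> \<le> real k * f"
  shows "\<bar>stair f d \<theta> s - stair f d \<theta> t\<bar> \<le> real k * f"
proof -
  have f: "0 < f" using assms by simp
  have "s \<le> t + of_int (int k) * f" "t \<le> s + of_int (int k) * f" using assms(3) by auto
  from this[THEN stair_mono[OF assms(1,2), of _ _ \<theta>]]
  have "stair f d \<theta> s \<le> stair f d \<theta> t + of_int (int k) * f"
    "stair f d \<theta> t \<le> stair f d \<theta> s + of_int (int k) * f"
    using stair_shift[OF f, of d \<theta> _ "int k"] by (simp_all only: )
  then show ?thesis by auto
qed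

lemma threshold_bounds:
  fixes d f \<theta> :: real
  assumes "0 \<le> d" "d < f" "0 \<le> \<theta>" "\<theta> < 1"
  shows "0 \<le> \<theta> * d" "\<theta> * d \<le> d" "d \<le> d + \<theta> * (f - d)" "d + \<theta> * (f - d) < f"
    "d > 0 \<Longrightarrow> \<theta> * d < d"
proof -
  have "\<theta> * (f - d) < 1 * (f - d)" using assms by (intro mult_strict_right_mono) auto
  then show "d + \<theta> * (f - d) < f" by simp
  show "0 \<le> \<theta> * d" "d \<le> d + \<theta> * (f - d)" using assms by auto
  show "\<theta> * d \<le> d" using assms mult_right_mono[of \<theta> 1 d] by simp
  show "\<theta> * d < d" if "d > 0" using assms that by simp
qed

lemma ceiling_divide_eq:
  fixes f :: real
  assumes "0 < f"
  shows "- f < t \<Longrightarrow> t \<le> 0 \<Longrightarrow> \<lceil>t / f\<rceil> = 0" "0 < t \<Longrightarrow> t \<le> f \<Longrightarrow> \<lceil>t / f\<rceil> = 1"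
  using assms by (simp_all add: ceiling_eq_iff pos_divide_le_eq pos_less_divide_eq)

lemma stair_fixes:
  assumes "0 \<le> d" "d < f" "0 \<le> \<theta>" "\<theta> < 1"
  shows "stair f d \<theta> 0 = 0" "stair f d \<theta> d = d"
proof -
  note b = threshold_bounds[OF assms]
  have f: "0 < f" using assms by simp
  have "\<lceil>(0 - \<theta> * d) / f\<rceil> = 0"
    using assms(1,2) b by (intro ceiling_divide_eq(1)[OF f]) linarith+
  moreover have "\<lceil>(0 - (d + \<theta> * (f - d))) / f\<rceil> = 0"
    using assms(1,2) b by (intro ceiling_divide_eq(1)[OF f]) linarith+
  ultimately show "stair f d \<theta> 0 = 0" by (simp add: stair_def)
  have "\<lceil>(d - (d + \<theta> * (f - d))) / f\<rceil> = 0"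
    using assms(1,2) b by (intro ceiling_divide_eq(1)[OF f]) linarith+
  moreover have "d > 0 \<Longrightarrow> \<lceil>(d - \<theta> * d) / f\<rceil> = 1"
    using assms(1,2) b by (intro ceiling_divide_eq(2)[OF f]) linarith+
  ultimately show "stair f d \<theta> d = d"
    unfolding stair_def using assms(1) by (cases "d = 0") auto
qed

lemma stair_mem_grid:
  assumes "0 \<le> d" "d < f" "0 \<le> \<theta>" "\<theta> < 1" "\<bar>s\<bar> \<le> real N * f"
  shows "stair f d \<theta> s \<in> grid f d N"
proof -
  have f: "0 < f" using assms by simp
  define \<alpha> where "\<alpha> = \<theta> * d"
  define \<beta> where "\<beta> = d + \<theta> * (f - d)"
  have ab: "0 \<le> \<alpha>" "\<alpha> \<le> \<beta>" "\<beta> < f"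
    using threshold_bounds[OF assms(1-4)] by (auto simp: \<alpha>_def \<beta>_def)
  define A where "A = \<lceil>(s - \<alpha>) / f\<rceil>"
  define B where "B = \<lceil>(s - \<beta>) / f\<rceil>"
  \<comment> \<open>As \<open>\<alpha> \<le> \<beta> < \<alpha> + f\<close>, the two staircases differ by at most one step.\<close>
  have "B \<le> A" unfolding A_def B_def
    using ab f by (intro ceiling_mono divide_right_mono) auto
  moreover have "A \<le> B + 1"
  proof -
    have "(s - \<alpha>) / f \<le> (s - \<beta> + f) / f" using ab f by (intro divide_right_mono) auto
    also have "\<dots> = (s - \<beta>) / f + 1" using f by (simp add: add_divide_distrib)
    finally have "(s - \<alpha>) / f \<le> (s - \<beta>) / f + 1" .
    then have "A \<le> \<lceil>(s - \<beta>) / f + 1\<rceil>" unfolding A_def by (rule ceiling_mono)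
    then show ?thesis by (simp add: B_def)
  qed
  ultimately have AB: "A = B \<or> A = B + 1" by auto
  have "(s - \<beta>) / f \<le> real N"
    using ab f assms by (simp add: pos_divide_le_eq abs_le_iff)
  moreover have "- real N - 1 < (s - \<beta>) / f"
    using ab f assms(5) unfolding pos_less_divide_eq[OF f] by (simp add: abs_le_iff left_diff_distrib)
  ultimately have "B \<in> {- int N..int N}" unfolding B_def
    by (simp add: ceiling_le_iff le_ceiling_iff)
  moreover have "stair f d \<theta> s = of_int B * f + (if A = B then 0 else d)"
    using AB unfolding stair_def \<alpha>_def[symmetric] \<beta>_def[symmetric] A_def[symmetric] B_def[symmetric]
    by (auto simp: algebra_simps)
  ultimately show ?thesis
    unfolding grid_def by (intro image_eqI[of _ _ "(B, if A = B then 0 else d)"]) auto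
qed

text \<open>
  As a function of the threshold, the rounded value jumps at most once, from the upper to the lower end
  of the cell of \<open>s\<close>, at the relative position of \<open>s\<close> in this cell.
\<close>

lemma stair_switch:
  assumes "0 \<le> d" "d < f"
  obtains \<phi> lo hi where "0 \<le> \<phi>" "\<phi> \<le> 1" "s = lo + \<phi> * (hi - lo)"
    "\<And>\<theta>. 0 \<le> \<theta> \<Longrightarrow> \<theta> < 1 \<Longrightarrow> stair f d \<theta> s = (if \<theta> < \<phi> then hi else lo)"
proof -
  have f: "0 < f" using assms by simp
  \<comment> \<open>Shifting by a multiple of \<open>f\<close> moves \<open>s\<close> to \<open>\<rho> \<in> [0, f)\<close>, which lies in one of the two grid cells
      \<open>[0, d]\<close> and \<open>[d, f]\<close>.\<close>
  define k where "k = \<lfloor>s / f\<rfloor>"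
  define \<rho> where "\<rho> = s - of_int k * f"
  have "of_int k \<le> s / f" "s / f < of_int k + 1" unfolding k_def by linarith+
  then have \<rho>: "0 \<le> \<rho>" "\<rho> < f" using f by (auto simp: \<rho>_def field_simps)
  have st: "stair f d \<theta> s = stair f d \<theta> \<rho> + of_int k * f" for \<theta>
    using stair_shift[OF f, of d \<theta> \<rho> k] by (simp add: \<rho>_def)
  have s: "s = of_int k * f + \<rho>" by (simp add: \<rho>_def)
  show thesis
  proof (cases "\<rho> < d")
    case True
    then have d: "0 < d" using \<rho> by simp
    have "stair f d \<theta> \<rho> = (if \<theta> < \<rho> / d then d else 0)" if th: "0 \<le> \<theta>" "\<theta> < 1" for \<theta>
    proof -
      note b = threshold_bounds[OF assms th]
      have B: "\<lceil>(\<rho> - (d + \<theta> * (f - d))) / f\<rceil> = 0"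
        using True \<rho> b by (intro ceiling_divide_eq(1)[OF f]) linarith+
      show ?thesis
      proof (cases "\<theta> * d < \<rho>")
        case True
        then have "\<lceil>(\<rho> - \<theta> * d) / f\<rceil> = 1"
          using \<rho> b by (intro ceiling_divide_eq(2)[OF f]) linarith+
        then show ?thesis using True d by (simp add: stair_def B pos_less_divide_eq)
      next
        case False
        then have "\<lceil>(\<rho> - \<theta> * d) / f\<rceil> = 0"
          using \<rho> b assms by (intro ceiling_divide_eq(1)[OF f]) linarith+
        then show ?thesis using False d by (simp add: stair_def B pos_less_divide_eq)
      qed
    qed
    then show thesis
      using \<rho> d True st s by (intro that[of "\<rho> / d" "of_int k * f" "of_int k * f + d"]) auto
  next
    case False
    have "stair f d \<theta> \<rho> = (if \<theta> < (\<rho> - d) / (f - d) then f else d)" if th: "0 \<le> \<theta>" "\<theta> < 1" for \<theta>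
    proof -
      note b = threshold_bounds[OF assms th]
      have "d > 0 \<Longrightarrow> \<lceil>(\<rho> - \<theta> * d) / f\<rceil> = 1"
        using False \<rho> b by (intro ceiling_divide_eq(2)[OF f]) linarith+
      then have A: "d * of_int \<lceil>(\<rho> - \<theta> * d) / f\<rceil> = d" using assms by (cases "d = 0") auto
      show ?thesis
      proof (cases "\<theta> * (f - d) < \<rho> - d")
        case True
        then have "\<lceil>(\<rho> - (d + \<theta> * (f - d))) / f\<rceil> = 1"
          using \<rho> b assms by (intro ceiling_divide_eq(2)[OF f]) linarith+
        then show ?thesis using True assms unfolding stair_def A by (simp add: pos_less_divide_eq)
      next
        case F: False
        then have "\<lceil>(\<rho> - (d + \<theta> * (f - d))) / f\<rceil> = 0"
          using \<rho> b assms by (intro ceiling_divide_eq(1)[OF f]) linarith+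
        then show ?thesis using F assms unfolding stair_def A by (simp add: pos_less_divide_eq)
      qed
    qed
    then show thesis
      using \<rho> assms False st s
      by (intro that[of "(\<rho> - d) / (f - d)" "of_int k * f + d" "of_int k * f + f"]) auto
  qed
qed

text \<open>
  A single distribution of thresholds rounds all points of \<open>T\<close> simultaneously and without bias.
  The common threshold is what makes \<open>stair_nonexpansive\<close> applicable to pairs of rounded points.
\<close>

lemma stair_average:
  assumes "0 \<le> d" "d < f" "finite T"
  obtains \<Theta> w where "finite \<Theta>" "\<Theta> \<subseteq> {0..<1}" "\<And>\<theta>. \<theta> \<in> \<Theta> \<Longrightarrow> 0 \<le> w \<theta>" "sum w \<Theta> = 1"
    "\<And>s. s \<in> T \<Longrightarrow> (\<Sum>\<theta>\<in>\<Theta>. w \<theta> * stair f d \<theta> s) = s"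
proof -
  \<comment> \<open>Bundling the three values makes the choice a single one.\<close>
  define switch where "switch s p \<longleftrightarrow> (case p of (\<phi>, lo, hi) \<Rightarrow>
      0 \<le> \<phi> \<and> \<phi> \<le> 1 \<and> s = lo + \<phi> * (hi - lo) \<and>
      (\<forall>\<theta>. 0 \<le> \<theta> \<longrightarrow> \<theta> < 1 \<longrightarrow> stair f d \<theta> s = (if \<theta> < \<phi> then hi else lo)))" for s p
  have "\<exists>p. switch s p" for s
  proof -
    obtain \<phi> lo hi where "0 \<le> \<phi>" "\<phi> \<le> 1" "s = lo + \<phi> * (hi - lo)"
      "\<And>\<theta>. 0 \<le> \<theta> \<Longrightarrow> \<theta> < 1 \<Longrightarrow> stair f d \<theta> s = (if \<theta> < \<phi> then hi else lo)"
      using stair_switch[OF assms(1,2), of s] by blast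
    then have "switch s (\<phi>, lo, hi)" unfolding switch_def prod.case by blast
    then show ?thesis ..
  qed
  then obtain F where F: "\<And>s. switch s (F s)" by metis
  define \<phi> lo hi where "\<phi> s = fst (F s)" and "lo s = fst (snd (F s))" and "hi s = snd (snd (F s))" for s
  have sw: "0 \<le> \<phi> s" "\<phi> s \<le> 1" "lo s + \<phi> s * (hi s - lo s) = s"
    "0 \<le> \<theta> \<Longrightarrow> \<theta> < 1 \<Longrightarrow> stair f d \<theta> s = (if \<theta> < \<phi> s then hi s else lo s)" for s \<theta>
    using F[of s] unfolding switch_def \<phi>_def lo_def hi_def case_prod_unfold by auto
  obtain \<Theta> w where tw: "finite \<Theta>" "\<Theta> \<subseteq> {0..<1}" "\<And>\<theta>. \<theta> \<in> \<Theta> \<Longrightarrow> 0 \<le> w \<theta>" "sum w \<Theta> = 1"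
    "\<And>v. v \<in> \<phi> ` T \<Longrightarrow> (\<Sum>\<theta>\<in>{\<theta>\<in>\<Theta>. \<theta> < v}. w \<theta>) = (v :: real)"
  proof -
    have "finite (\<phi> ` T)" "\<phi> ` T \<subseteq> {0..1}" using assms(3) sw(1,2) by auto
    from threshold_weights[OF this] show thesis using that by blast
  qed
  have "(\<Sum>\<theta>\<in>\<Theta>. w \<theta> * stair f d \<theta> s) = s" if "s \<in> T" for s
  proof -
    have "(\<Sum>\<theta>\<in>\<Theta>. w \<theta> * stair f d \<theta> s) =
      (\<Sum>\<theta>\<in>\<Theta>. lo s * w \<theta> + (hi s - lo s) * (if \<theta> < \<phi> s then w \<theta> else 0))"
    proof (rule sum.cong[OF refl])
      fix \<theta> assume "\<theta> \<in> \<Theta>"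
      then have "stair f d \<theta> s = (if \<theta> < \<phi> s then hi s else lo s)" using tw(2) by (intro sw(4)) auto
      then show "w \<theta> * stair f d \<theta> s = lo s * w \<theta> + (hi s - lo s) * (if \<theta> < \<phi> s then w \<theta> else 0)"
        by (simp add: algebra_simps)
    qed
    also have "\<dots> = lo s * sum w \<Theta> + (hi s - lo s) * (\<Sum>\<theta>\<in>\<Theta>. if \<theta> < \<phi> s then w \<theta> else 0)"
      by (simp add: sum.distrib sum_distrib_left)
    also have "(\<Sum>\<theta>\<in>\<Theta>. if \<theta> < \<phi> s then w \<theta> else 0) = (\<Sum>\<theta>\<in>{\<theta>\<in>\<Theta>. \<theta> < \<phi> s}. w \<theta>)"
      using tw(1) by (simp add: sum.inter_filter)
    also have "\<dots> = \<phi> s" using tw(5) that by auto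
    finally have "(\<Sum>\<theta>\<in>\<Theta>. w \<theta> * stair f d \<theta> s) = lo s + \<phi> s * (hi s - lo s)"
      by (simp add: tw(4) mult.commute)
    then show ?thesis using sw(3) by simp
  qed
  then show thesis using tw by (intro that) auto
qed

section \<open>Decomposition of flows in layered networks\<close>

text \<open>
  A unit flow from the source \<open>s0\<close> through the layers is a convex combination of paths. Paths
  themselves never appear: \<open>K j s\<close> is any family of point sets that contains 0 at the source and
  is closed under appending the contribution \<open>e i a\<close> of an arc, and the claim is proved by pushing
  averages forward. At stage \<open>j\<close> every node \<open>s\<close> with positive throughput \<open>v j s\<close> carries a point \<open>p s\<close>
  of its hull such that the throughput-weighted sum of these points is the contribution of all
  arcs so far. Flow conservation says that the weights of the arcs leaving \<open>s\<close> sum up to \<open>v j s\<close>, so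
  the mass at \<open>s\<close> is passed on completely.
\<close>

lemma layered_flow_decomposition:
  fixes K :: "nat \<Rightarrow> 's \<Rightarrow> 'v :: real_vector set"
    and A :: "nat \<Rightarrow> 'a set" and y :: "nat \<Rightarrow> 'a \<Rightarrow> real" and v :: "nat \<Rightarrow> 's \<Rightarrow> real"
  assumes S: "finite S" "s0 \<in> S"
    and A: "\<And>i. finite (A i)" "\<And>i a. a \<in> A i \<Longrightarrow> tail a \<in> S" "\<And>i a. a \<in> A i \<Longrightarrow> head a \<in> S"
    and nonneg: "\<And>i a. i \<in> {1..n} \<Longrightarrow> a \<in> A i \<Longrightarrow> 0 \<le> y i a"
    and source: "\<And>s. v 0 s = of_bool (s = s0)" and base: "0 \<in> K 0 s0"
    and outflow: "\<And>i s. i < n \<Longrightarrow> s \<in> S \<Longrightarrow> v i s = (\<Sum>a\<in>{a\<in>A (Suc i). tail a = s}. y (Suc i) a)"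
    and inflow: "\<And>i s. i < n \<Longrightarrow> s \<in> S \<Longrightarrow> v (Suc i) s = (\<Sum>a\<in>{a\<in>A (Suc i). head a = s}. y (Suc i) a)"
    and step: "\<And>i a p. i < n \<Longrightarrow> a \<in> A (Suc i) \<Longrightarrow> p \<in> K i (tail a) \<Longrightarrow>
                 p + e (Suc i) a \<in> K (Suc i) (head a)"
    and "j \<le> n"
  shows "\<exists>p. (\<forall>s\<in>S. 0 < v j s \<longrightarrow> p s \<in> convex hull (K j s)) \<and>
             (\<Sum>s\<in>S. v j s *\<^sub>R p s) = (\<Sum>i=1..j. \<Sum>a\<in>A i. y i a *\<^sub>R e i a)"
  using \<open>j \<le> n\<close>
proof (induction j)
  case 0
  show ?case using source base
    by (intro exI[of _ "\<lambda>_. 0"]) (auto simp: hull_inc)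
next
  case (Suc j)
  then obtain p where p: "\<And>s. s \<in> S \<Longrightarrow> 0 < v j s \<Longrightarrow> p s \<in> convex hull (K j s)"
    and psum: "(\<Sum>s\<in>S. v j s *\<^sub>R p s) = (\<Sum>i=1..j. \<Sum>a\<in>A i. y i a *\<^sub>R e i a)"
    by auto
  have j: "j < n" using Suc.prems by simp
  let ?A = "A (Suc j)" and ?y = "y (Suc j)" and ?e = "e (Suc j)"
  have y0: "0 \<le> ?y a" if "a \<in> ?A" for a using nonneg[of "Suc j" a] that j by simp
  have mem: "p (tail a) + ?e a \<in> convex hull (K (Suc j) (head a))" if a: "a \<in> ?A" "0 < ?y a" for a
  proof -
    have "?y a \<le> v j (tail a)"
      unfolding outflow[OF j A(2)[OF a(1)]]
      by (rule member_le_sum) (use A(1) a y0 in auto)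
    then have "p (tail a) \<in> convex hull (K j (tail a))" using p A(2) a by force
    then have "?e a + p (tail a) \<in> convex hull ((\<lambda>q. ?e a + q) ` K j (tail a))"
      unfolding convex_hull_translation by blast
    moreover have "(\<lambda>q. ?e a + q) ` K j (tail a) \<subseteq> K (Suc j) (head a)"
      using step[OF j a(1)] by (auto simp: add.commute)
    ultimately show ?thesis by (metis add.commute hull_mono subsetD)
  qed
  \<comment> \<open>A node at the next stage receives the average of its extended predecessors, weighted by arc flow.\<close>
  define p' where "p' s = (\<Sum>a\<in>{a\<in>?A. head a = s}. (?y a / v (Suc j) s) *\<^sub>R (p (tail a) + ?e a))" for s
  have p'_mem: "p' s \<in> convex hull (K (Suc j) s)" if s: "s \<in> S" "0 < v (Suc j) s" for s
  proof -
    \<comment> \<open>The tail of an arc with positive flow has positive throughput, so it carries a point of the hull.\<close>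
    let ?B = "{a\<in>?A. head a = s \<and> 0 < ?y a}"
    have fin: "finite {a\<in>?A. head a = s}" using A(1) by simp
    have sub: "?B \<subseteq> {a\<in>?A. head a = s}" by auto
    have zero: "?y a = 0" if "a \<in> {a\<in>?A. head a = s} - ?B" for a
      using that y0[of a] by auto
    have "p' s = (\<Sum>a\<in>?B. (?y a / v (Suc j) s) *\<^sub>R (p (tail a) + ?e a))"
      unfolding p'_def by (rule sum.mono_neutral_right[OF fin sub])
        (intro ballI, drule zero, simp)
    also have "\<dots> \<in> convex hull (K (Suc j) s)"
    proof (rule convex_sum)
      have "(\<Sum>a\<in>?B. ?y a) = v (Suc j) s"
        unfolding inflow[OF j s(1)] by (rule sum.mono_neutral_left[OF fin sub]) (use zero in blast)
      then show "(\<Sum>a\<in>?B. ?y a / v (Suc j) s) = 1" using s(2) by (simp flip: sum_divide_distrib)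
    next
      show "finite ?B" using finite_subset[OF sub fin] .
      show "0 \<le> ?y a / v (Suc j) s" if "a \<in> ?B" for a using that s(2) by simp
      show "p (tail a) + ?e a \<in> convex hull (K (Suc j) s)" if "a \<in> ?B" for a
        using mem that by blast
    qed simp
    finally show ?thesis .
  qed
  have scaled: "v (Suc j) s *\<^sub>R p' s = (\<Sum>a\<in>{a\<in>?A. head a = s}. ?y a *\<^sub>R (p (tail a) + ?e a))"
    if s: "s \<in> S" for s
  proof (cases "v (Suc j) s = 0")
    case True
    then have "\<forall>a\<in>{a\<in>?A. head a = s}. ?y a = 0"
      unfolding inflow[OF j s] using A(1) y0 by (subst (asm) sum_nonneg_eq_0_iff) auto
    then show ?thesis using True by simp
  qed (simp add: p'_def scaleR_sum_right)
  have "(\<Sum>s\<in>S. v (Suc j) s *\<^sub>R p' s) =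
      (\<Sum>s\<in>S. \<Sum>a\<in>{a\<in>?A. head a = s}. ?y a *\<^sub>R (p (tail a) + ?e a))"
    by (rule sum.cong[OF refl scaled])
  also have "\<dots> = (\<Sum>a\<in>?A. ?y a *\<^sub>R (p (tail a) + ?e a))"
    by (rule sum.group) (use A S in auto)
  also have "\<dots> = (\<Sum>a\<in>?A. ?y a *\<^sub>R p (tail a)) + (\<Sum>a\<in>?A. ?y a *\<^sub>R ?e a)"
    by (simp add: scaleR_add_right sum.distrib)
  also have "(\<Sum>a\<in>?A. ?y a *\<^sub>R p (tail a)) = (\<Sum>s\<in>S. \<Sum>a\<in>{a\<in>?A. tail a = s}. ?y a *\<^sub>R p (tail a))"
    by (rule sum.group[symmetric]) (use A S in auto)
  also have "\<dots> = (\<Sum>s\<in>S. v j s *\<^sub>R p s)"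
    by (rule sum.cong) (auto simp: outflow[OF j] scaleR_sum_left)
  finally show ?case using psum p'_mem by (intro exI[of _ p']) auto
qed

section \<open>The network of partial sums\<close>

lemma lookup_scaleR:
  "Poly_Mapping.lookup (r *\<^sub>R x) k = r *\<^sub>R Poly_Mapping.lookup x k"
proof -
  have "finite {i. r *\<^sub>R Poly_Mapping.lookup x i \<noteq> 0}"
    by (rule finite_subset[OF _ finite_lookup[of x]]) auto
  then show ?thesis
    unfolding scaleR_poly_mapping_def by (simp add: Abs_poly_mapping_inverse)
qed

lemma keys_subset_iff: "Poly_Mapping.keys p \<subseteq> A \<longleftrightarrow> (\<forall>k. k \<notin> A \<longrightarrow> Poly_Mapping.lookup p k = 0)"
  by (metis in_keys_iff subset_iff)

lemma convex_xf_space: "convex (xf_space n)"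
proof -
  have "xf_space n = {z. (\<forall>k. k \<notin> {1..n} \<longrightarrow> Poly_Mapping.lookup (fst z) k = 0) \<and>
      (\<forall>k. k \<notin> {0..n} \<longrightarrow> Poly_Mapping.lookup (snd z) k = 0)}"
    unfolding xf_space_def case_prod_unfold keys_subset_iff by (rule refl)
  then show ?thesis by (auto simp: convex_def lookup_add lookup_scaleR)
qed

text \<open>
  An arc \<open>(i, s, s', b)\<close> at stage \<open>i\<close> stands for the choice \<open>x\<^sub>i = b\<close>, \<open>f\<^sub>i = s' - s\<close> when
  \<open>f\<^sub>0 + \<dots> + f\<^bsub>i - 1\<^esub> = s\<close>.
\<close>

type_synonym arc = "nat \<times> real \<times> real \<times> bool"

definition stage_arcs :: "real set \<Rightarrow> real \<Rightarrow> (real \<times> real \<times> bool) set" where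
  "stage_arcs S c = {(s, s', b). s \<in> S \<and> s' \<in> S \<and> \<bar>s' - s\<bar> \<le> of_bool b * c}"

definition network :: "nat \<Rightarrow> real set \<Rightarrow> (nat \<Rightarrow> real) \<Rightarrow> arc set" where
  "network n S u = (SIGMA i:{1..n}. stage_arcs S (u i))"

definition balance_coeff :: "nat \<Rightarrow> real \<Rightarrow> arc \<Rightarrow> real" where
  "balance_coeff j s = (\<lambda>(i, s1, s2, b). of_bool (i = j \<and> s2 = s) - of_bool (i = Suc j \<and> s1 = s))"

definition x_coeff :: "nat \<Rightarrow> arc \<Rightarrow> real" where
  "x_coeff j = (\<lambda>(i, s1, s2, b). of_bool (i = j \<and> b))"

definition f_coeff :: "nat \<Rightarrow> arc \<Rightarrow> real" where
  "f_coeff j = (\<lambda>(i, s1, s2, b). of_bool (i = j) * (s2 - s1))"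

text \<open>
  A unit flow \<open>y\<close> from the node \<open>(0, 0)\<close> to the node \<open>(n, d)\<close>, together with the point \<open>z\<close> whose coordinates
  are the totals of the arcs' contributions. The two indicators on the right of the balance
  equation are the sink and the source; for \<open>n = 0\<close> they have to cancel, which forces \<open>d = 0\<close> when
  \<open>0 \<in> S\<close>.
\<close>

definition path_flow :: "nat \<Rightarrow> real set \<Rightarrow> (nat \<Rightarrow> real) \<Rightarrow> real \<Rightarrow> point \<Rightarrow> (arc \<Rightarrow> real) \<Rightarrow> bool" where
  "path_flow n S u d z y \<longleftrightarrow>
     (\<forall>a\<in>network n S u. 0 \<le> y a) \<and>
     (\<forall>j\<in>{0..n}. \<forall>s\<in>S. (\<Sum>a\<in>network n S u. balance_coeff j s a * y a) =
        of_bool (j = n \<and> s = d) - of_bool (j = 0 \<and> s = 0)) \<and>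
     (\<forall>j\<in>{1..n}. Poly_Mapping.lookup (fst z) j = (\<Sum>a\<in>network n S u. x_coeff j a * y a)) \<and>
     (\<forall>j\<in>{0..n}. Poly_Mapping.lookup (snd z) j = (\<Sum>a\<in>network n S u. f_coeff j a * y a))"

lemma stage_arcs_subset: "stage_arcs S c \<subseteq> S \<times> S \<times> UNIV"
  by (auto simp: stage_arcs_def)

lemma finite_stage_arcs: "finite S \<Longrightarrow> finite (stage_arcs S c)"
  by (rule finite_subset[OF stage_arcs_subset]) auto

lemma finite_network: "finite S \<Longrightarrow> finite (network n S u)"
  by (auto simp: network_def finite_stage_arcs)

lemma card_network:
  assumes "finite S"
  shows "card (network n S u) \<le> n * (2 * card S ^ 2)"
proof -
  have "card (stage_arcs S c) \<le> card (S \<times> S \<times> (UNIV :: bool set))" for c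
    using assms by (intro card_mono stage_arcs_subset) auto
  then have "card (stage_arcs S c) \<le> 2 * card S ^ 2" for c
    using assms by (simp add: card_cartesian_product power2_eq_square mult_ac)
  then have "(\<Sum>i=1..n. card (stage_arcs S (u i))) \<le> (\<Sum>i=1..n. 2 * card S ^ 2)"
    by (intro sum_mono)
  then show ?thesis
    using finite_stage_arcs[OF assms] by (simp add: network_def card_SigmaI)
qed

lemma sum_network:
  assumes "finite S"
  shows "(\<Sum>a\<in>network n S u. g a) = (\<Sum>i=1..n. \<Sum>a\<in>stage_arcs S (u i). g (i, a))"
  unfolding network_def by (subst sum.Sigma) (auto simp: finite_stage_arcs assms)

lemma convex_path_flow: "convex {z. \<exists>y. path_flow n S u d z y}"
proof (rule convexI)
  fix z z' :: point and t t' :: real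
  assume "z \<in> {z. \<exists>y. path_flow n S u d z y}" "z' \<in> {z. \<exists>y. path_flow n S u d z y}"
    and t: "0 \<le> t" "0 \<le> t'" "t + t' = 1"
  then obtain y y' where y: "path_flow n S u d z y" "path_flow n S u d z' y'" by auto
  let ?y = "\<lambda>a. t * y a + t' * y' a"
  have lin: "(\<Sum>a\<in>network n S u. g a * ?y a) =
      t * (\<Sum>a\<in>network n S u. g a * y a) + t' * (\<Sum>a\<in>network n S u. g a * y' a)" for g
    by (simp add: sum_distrib_left sum.distrib algebra_simps)
  have "t * c + t' * c = c" for c :: real
    using t by (simp flip: distrib_right)
  then have "path_flow n S u d (t *\<^sub>R z + t' *\<^sub>R z') ?y"
    using y t unfolding path_flow_def lin by (simp add: lookup_add lookup_scaleR)
  then show "t *\<^sub>R z + t' *\<^sub>R z' \<in> {z. \<exists>y. path_flow n S u d z y}" by blast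
qed

section \<open>Flows project into the convex hull\<close>

lemma flow_set_append:
  assumes p: "p \<in> flow_set i s l u"
    and a: "\<bar>s' - s\<bar> \<le> of_bool b * u (Suc i)" and l: "l (Suc i) = - u (Suc i)"
  shows "p + (Poly_Mapping.single (Suc i) (of_bool b), Poly_Mapping.single (Suc i) (s' - s))
           \<in> flow_set (Suc i) s' l u"
proof -
  obtain x f where xf: "p = (x, f)" by (cases p)
  let ?x = "x + Poly_Mapping.single (Suc i) (of_bool b)"
  let ?f = "f + Poly_Mapping.single (Suc i) (s' - s)"
  note m = p[unfolded flow_set_def xf xf_space_def mem_Collect_eq prod.case]
  have keys: "Poly_Mapping.keys x \<subseteq> {1..i}" "Poly_Mapping.keys f \<subseteq> {0..i}" using m by auto
  then have "Suc i \<notin> Poly_Mapping.keys x" "Suc i \<notin> Poly_Mapping.keys f" by auto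
  then have top: "Poly_Mapping.lookup ?x (Suc i) = of_bool b" "Poly_Mapping.lookup ?f (Suc i) = s' - s"
    by (simp_all add: lookup_add in_keys_iff)
  have old: "Poly_Mapping.lookup ?x j = Poly_Mapping.lookup x j"
    "Poly_Mapping.lookup ?f j = Poly_Mapping.lookup f j" if "j \<le> i" for j
    using that by (simp_all add: lookup_add lookup_single when_def)
  have "Poly_Mapping.keys ?x \<subseteq> {1..Suc i}" "Poly_Mapping.keys ?f \<subseteq> {0..Suc i}"
    using keys keys_add[of x "Poly_Mapping.single (Suc i) (of_bool b :: real)"]
      keys_add[of f "Poly_Mapping.single (Suc i) (s' - s)"]
    by (force split: if_splits)+
  moreover have "\<forall>j\<in>{1..Suc i}. Poly_Mapping.lookup ?x j \<in> {0, 1}"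
  proof
    fix j assume "j \<in> {1..Suc i}"
    then consider "j \<in> {1..i}" | "j = Suc i" by force
    then show "Poly_Mapping.lookup ?x j \<in> {0, 1}"
    proof cases
      case 1
      then show ?thesis using m old(1)[of j] by auto
    qed (use top in simp)
  qed
  moreover have "(\<Sum>j=0..Suc i. Poly_Mapping.lookup ?f j) = s'"
    using m old top by simp
  moreover have "\<forall>j\<in>{0..Suc i}. l j * x_ext ?x j \<le> Poly_Mapping.lookup ?f j \<and>
      Poly_Mapping.lookup ?f j \<le> u j * x_ext ?x j"
  proof
    fix j assume "j \<in> {0..Suc i}"
    then consider "j \<le> i" | "j = Suc i" by force
    then show "l j * x_ext ?x j \<le> Poly_Mapping.lookup ?f j \<and> Poly_Mapping.lookup ?f j \<le> u j * x_ext ?x j"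
    proof cases
      case 1
      then have "x_ext ?x j = x_ext x j" using old by (simp add: x_ext_def)
      then show ?thesis using m old[OF 1] 1 by auto
    next
      case 2
      then show ?thesis using a l top by (auto simp: x_ext_def abs_le_iff mult.commute)
    qed
  qed
  ultimately show ?thesis unfolding xf flow_set_def xf_space_def by auto
qed

lemma path_flow_imp_convex_hull:
  assumes S: "finite S" "0 \<in> S" "d \<in> S"
    and z: "z \<in> xf_space n" and y: "path_flow n S u d z y"
    and l: "\<And>j. j \<in> {1..n} \<Longrightarrow> l j = - u j" "l 0 = 0" "u 0 = 0"
  shows "z \<in> convex hull (flow_set n d l u)"
proof -
  define A where "A i = stage_arcs S (u i)" for i
  define tail :: "real \<times> real \<times> bool \<Rightarrow> real" where "tail a = fst a" for a
  define head :: "real \<times> real \<times> bool \<Rightarrow> real" where "head a = fst (snd a)" for a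
  define e :: "nat \<Rightarrow> real \<times> real \<times> bool \<Rightarrow> point" where
    "e i a = (Poly_Mapping.single i (of_bool (snd (snd a))), Poly_Mapping.single i (head a - tail a))" for i a
  define v where "v i s = of_bool (i = 0 \<and> s = 0) +
    (\<Sum>a\<in>network n S u. of_bool (fst a = i \<and> head (snd a) = s) * y a)" for i s
  have finA: "finite (A i)" for i unfolding A_def by (rule finite_stage_arcs[OF S(1)])
  have stage: "(\<Sum>a\<in>network n S u. of_bool (fst a = i \<and> g (snd a) = s) * y a) =
      (\<Sum>a\<in>{a\<in>A i. g a = s}. y (i, a))" if "i \<in> {1..n}" for i s and g :: "_ \<Rightarrow> real"
  proof -
    have "(\<Sum>a\<in>network n S u. of_bool (fst a = i \<and> g (snd a) = s) * y a) =
      (\<Sum>k=1..n. if k = i then (\<Sum>a\<in>A i. if g a = s then y (i, a) else 0) else 0)"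
      unfolding sum_network[OF S(1)] A_def[symmetric]
      by (intro sum.cong refl) (auto intro!: sum.cong simp: of_bool_def)
    also have "\<dots> = (\<Sum>a\<in>A i. if g a = s then y (i, a) else 0)" using that by simp
    also have "\<dots> = (\<Sum>a\<in>{a\<in>A i. g a = s}. y (i, a))"
      using finA by (simp add: sum.inter_filter)
    finally show ?thesis .
  qed
  have cons: "v i s - (\<Sum>a\<in>network n S u. of_bool (fst a = Suc i \<and> tail (snd a) = s) * y a) =
      of_bool (i = n \<and> s = d)" if "i \<le> n" "s \<in> S" for i s
  proof -
    have "(\<Sum>a\<in>network n S u. balance_coeff i s a * y a) =
        of_bool (i = n \<and> s = d) - of_bool (i = 0 \<and> s = 0)"
      using y that unfolding path_flow_def by auto
    moreover have "(\<Sum>a\<in>network n S u. balance_coeff i s a * y a) =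
       (\<Sum>a\<in>network n S u. of_bool (fst a = i \<and> head (snd a) = s) * y a) -
       (\<Sum>a\<in>network n S u. of_bool (fst a = Suc i \<and> tail (snd a) = s) * y a)"
      unfolding sum_subtractf[symmetric]
      by (rule sum.cong) (auto simp: balance_coeff_def head_def tail_def left_diff_distrib)
    ultimately show ?thesis unfolding v_def by simp
  qed
  \<comment> \<open>The decomposition applies with the sets \<open>flow_set i s l u\<close> themselves as the set of points
      reachable at node \<open>(i, s)\<close>: an arc to \<open>s'\<close> appends the coordinate \<open>f = s' - s\<close>.\<close>
  have "\<exists>p. (\<forall>s\<in>S. 0 < v n s \<longrightarrow> p s \<in> convex hull (flow_set n s l u)) \<and>
             (\<Sum>s\<in>S. v n s *\<^sub>R p s) = (\<Sum>i=1..n. \<Sum>a\<in>A i. y (i, a) *\<^sub>R e i a)"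
  proof (rule layered_flow_decomposition[where K = "\<lambda>i s. flow_set i s l u" and ?s0.0 = 0
        and tail = tail and head = head and n = n])
    show "v 0 s = of_bool (s = 0)" for s
    proof -
      have "(\<Sum>a\<in>network n S u. of_bool (fst a = 0 \<and> head (snd a) = s) * y a) = 0"
        by (rule sum.neutral) (auto simp: network_def)
      then show ?thesis by (simp add: v_def)
    qed
    show "0 \<in> flow_set 0 0 l u"
      using l by (auto simp: flow_set_def xf_space_def zero_prod_def)
    show "v i s = (\<Sum>a\<in>{a\<in>A (Suc i). tail a = s}. y (Suc i, a))" if "i < n" "s \<in> S" for i s
      using cons[of i s] stage[of "Suc i" tail s] that by simp
    show "v (Suc i) s = (\<Sum>a\<in>{a\<in>A (Suc i). head a = s}. y (Suc i, a))" if "i < n" "s \<in> S" for i s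
      using stage[of "Suc i" head s] that by (simp add: v_def)
    show "p + e (Suc i) a \<in> flow_set (Suc i) (head a) l u"
      if "i < n" "a \<in> A (Suc i)" "p \<in> flow_set i (tail a) l u" for i a p
      unfolding e_def using that l(1)[of "Suc i"]
      by (intro flow_set_append[where s = "tail a"]) (auto simp: A_def stage_arcs_def head_def tail_def)
  qed (use S finA y in \<open>auto simp: A_def stage_arcs_def head_def tail_def path_flow_def network_def\<close>)
  then obtain p where p: "\<And>s. s \<in> S \<Longrightarrow> 0 < v n s \<Longrightarrow> p s \<in> convex hull (flow_set n s l u)"
    and sum: "(\<Sum>s\<in>S. v n s *\<^sub>R p s) = (\<Sum>i=1..n. \<Sum>a\<in>A i. y (i, a) *\<^sub>R e i a)" by auto
  \<comment> \<open>At the last stage all mass sits at \<open>d\<close>, so the average over that stage is the one point \<open>p d\<close>.\<close>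
  have vn: "v n s = of_bool (s = d)" if "s \<in> S" for s
  proof -
    have "(\<Sum>a\<in>network n S u. of_bool (fst a = Suc n \<and> tail (snd a) = s) * y a) = 0"
      by (rule sum.neutral) (auto simp: network_def)
    then show ?thesis using cons[of n s] that by simp
  qed
  have "(\<Sum>s\<in>S. v n s *\<^sub>R p s) = (\<Sum>s\<in>S. if s = d then p s else 0)"
    by (rule sum.cong) (auto simp: vn)
  also have "\<dots> = p d" using S by simp
  finally have "p d = (\<Sum>i=1..n. \<Sum>a\<in>A i. y (i, a) *\<^sub>R e i a)" using sum by simp
  also have "\<dots> = (\<Sum>a\<in>network n S u. y a *\<^sub>R e (fst a) (snd a))"
    unfolding sum_network[OF S(1)] A_def by simp
  also have "\<dots> = z"
  proof (rule prod_eqI; rule poly_mapping_eqI)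
    fix k
    have "Poly_Mapping.lookup (fst (\<Sum>a\<in>network n S u. y a *\<^sub>R e (fst a) (snd a))) k =
      (\<Sum>a\<in>network n S u. x_coeff k a * y a)"
      unfolding fst_sum lookup_sum
      by (rule sum.cong) (auto simp: e_def x_coeff_def lookup_scaleR lookup_single when_def)
    also have "\<dots> = Poly_Mapping.lookup (fst z) k"
    proof (cases "k \<in> {1..n}")
      case True
      then show ?thesis using y unfolding path_flow_def by auto
    next
      case False
      then have "(\<Sum>a\<in>network n S u. x_coeff k a * y a) = 0"
        by (intro sum.neutral) (auto simp: network_def x_coeff_def)
      moreover have "k \<notin> Poly_Mapping.keys (fst z)" using z False by (auto simp: xf_space_def)
      ultimately show ?thesis by (simp add: in_keys_iff)
    qed
    finally show "Poly_Mapping.lookup (fst (\<Sum>a\<in>network n S u. y a *\<^sub>R e (fst a) (snd a))) k =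
      Poly_Mapping.lookup (fst z) k" .
  next
    fix k
    have "Poly_Mapping.lookup (snd (\<Sum>a\<in>network n S u. y a *\<^sub>R e (fst a) (snd a))) k =
      (\<Sum>a\<in>network n S u. f_coeff k a * y a)"
      unfolding snd_sum lookup_sum
      by (rule sum.cong) (auto simp: e_def f_coeff_def head_def tail_def lookup_scaleR lookup_single when_def)
    also have "\<dots> = Poly_Mapping.lookup (snd z) k"
    proof (cases "k \<in> {0..n}")
      case True
      then show ?thesis using y unfolding path_flow_def by auto
    next
      case False
      then have "(\<Sum>a\<in>network n S u. f_coeff k a * y a) = 0"
        by (intro sum.neutral) (auto simp: network_def f_coeff_def)
      moreover have "k \<notin> Poly_Mapping.keys (snd z)" using z False by (auto simp: xf_space_def)
      ultimately show ?thesis by (simp add: in_keys_iff)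
    qed
    finally show "Poly_Mapping.lookup (snd (\<Sum>a\<in>network n S u. y a *\<^sub>R e (fst a) (snd a))) k =
      Poly_Mapping.lookup (snd z) k" .
  qed
  finally show ?thesis using p[OF S(3)] vn[OF S(3)] by simp
qed

section \<open>The convex hull lies in the projection\<close>

text \<open>
  A sequence \<open>\<sigma>\<close> of partial sums that stays in \<open>S\<close> is a path of the network; the indicator of its arcs is
  the required flow.
\<close>

lemma path_flow_of_path:
  assumes S: "finite S" and \<sigma>: "\<sigma> 0 = 0" "\<sigma> n = d" "\<And>i. i \<le> n \<Longrightarrow> \<sigma> i \<in> S"
    and step: "\<And>i. i \<in> {1..n} \<Longrightarrow> \<bar>\<sigma> i - \<sigma> (i - 1)\<bar> \<le> of_bool (\<beta> i) * u i"
    and x: "\<And>i. i \<in> {1..n} \<Longrightarrow> Poly_Mapping.lookup (fst z) i = of_bool (\<beta> i)"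
    and f: "\<And>i. i \<in> {1..n} \<Longrightarrow> Poly_Mapping.lookup (snd z) i = \<sigma> i - \<sigma> (i - 1)"
    and f0: "Poly_Mapping.lookup (snd z) 0 = 0"
  shows "\<exists>y. path_flow n S u d z y"
proof -
  define path where "path i = (\<sigma> (i - 1), \<sigma> i, \<beta> i)" for i
  define y where "y = (\<lambda>(i, a). of_bool (a = path i) :: real)"
  have path: "path i \<in> stage_arcs S (u i)" if "i \<in> {1..n}" for i
    using that step \<sigma> by (auto simp: path_def stage_arcs_def)
  have total: "(\<Sum>a\<in>network n S u. g a * y a) = (\<Sum>i=1..n. g (i, path i))" for g
    unfolding sum_network[OF S]
  proof (rule sum.cong[OF refl])
    fix i assume i: "i \<in> {1..n}"
    have "(\<Sum>a\<in>stage_arcs S (u i). g (i, a) * y (i, a)) =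
        (\<Sum>a\<in>stage_arcs S (u i). if a = path i then g (i, a) else 0)"
      by (rule sum.cong) (auto simp: y_def)
    then show "(\<Sum>a\<in>stage_arcs S (u i). g (i, a) * y (i, a)) = g (i, path i)"
      using path[OF i] finite_stage_arcs[OF S] by simp
  qed
  have at: "(\<Sum>i=1..n. of_bool (i = j) * g i) = (if j \<in> {1..n} then g j else 0)" for j and g :: "nat \<Rightarrow> real"
    by (simp add: of_bool_def if_distrib[of "\<lambda>c. c * _"] cong: if_cong)
  have "(\<Sum>a\<in>network n S u. balance_coeff j s a * y a) =
      of_bool (j = n \<and> s = d) - of_bool (j = 0 \<and> s = 0)" if "j \<le> n" for j s
  proof -
    have "(\<Sum>a\<in>network n S u. balance_coeff j s a * y a) =
      (\<Sum>i=1..n. of_bool (i = j) * of_bool (\<sigma> i = s)) - (\<Sum>i=1..n. of_bool (i = Suc j) * of_bool (\<sigma> (i - 1) = s))"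
      unfolding total sum_subtractf[symmetric]
      by (rule sum.cong) (auto simp: balance_coeff_def path_def)
    also have "\<dots> = (if j \<in> {1..n} then of_bool (\<sigma> j = s) else 0) - (if j < n then of_bool (\<sigma> j = s) else 0)"
      unfolding at by simp
    also have "\<dots> = of_bool (j = n \<and> s = d) - of_bool (j = 0 \<and> s = 0)"
      using that \<sigma>(1,2) by (cases "j = 0") (auto simp: Suc_le_eq)
    finally show ?thesis .
  qed
  moreover have "(\<Sum>a\<in>network n S u. x_coeff j a * y a) = (if j \<in> {1..n} then of_bool (\<beta> j) else 0)" for j
    unfolding total at[of j "\<lambda>i. of_bool (\<beta> i)", symmetric]
    by (rule sum.cong) (auto simp: x_coeff_def path_def)
  moreover have "(\<Sum>a\<in>network n S u. f_coeff j a * y a) = (if j \<in> {1..n} then \<sigma> j - \<sigma> (j - 1) else 0)" for j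
    unfolding total at[of j "\<lambda>i. \<sigma> i - \<sigma> (i - 1)", symmetric]
    by (rule sum.cong) (auto simp: f_coeff_def path_def)
  moreover have "\<forall>a\<in>network n S u. 0 \<le> y a" by (auto simp: y_def)
  ultimately have "path_flow n S u d z y"
    unfolding path_flow_def using x f f0 by (auto simp: not_less_eq_eq)
  then show ?thesis by blast
qed

text \<open>
  The partial sums of a feasible point need not lie on the grid. Rounding all of them with a common
  threshold keeps \<open>x\<close>, the end points 0 and \<open>d\<close> (both in the grid), and the bounds on the steps: those with
  \<open>x\<^sub>i = 1\<close> are multiples of \<open>f\<close>, and a step of size zero stays zero. Hence each rounded point is a path, and their average
  is the original point.
\<close>

lemma rounded_flow_average:
  fixes n \<kappa>bar :: nat and f d :: real and \<kappa> :: "nat \<Rightarrow> nat"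
  assumes f: "0 < f" and d: "0 \<le> d" "d < f"
    and \<kappa>: "\<And>j. j \<in> {1..n} \<Longrightarrow> \<kappa> j \<le> \<kappa>bar"
    and u: "\<And>j. j \<in> {1..n} \<Longrightarrow> u j = real (\<kappa> j) * f"
    and l: "\<And>j. j \<in> {1..n} \<Longrightarrow> l j = - u j" "l 0 = 0" "u 0 = 0"
    and z: "z \<in> flow_set n d l u"
  shows "\<exists>y. path_flow n (grid f d (n * \<kappa>bar)) u d z y"
proof -
  let ?S = "grid f d (n * \<kappa>bar)"
  obtain x g where xg: "z = (x, g)" by (cases z)
  note m = z[unfolded flow_set_def xg xf_space_def mem_Collect_eq prod.case]
  \<comment> \<open>The partial sums are the walk that is rounded; \<open>f\<^sub>0 = 0\<close>, so it starts at 0, and it ends at \<open>d\<close>.\<close>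
  define s where "s j = (\<Sum>i=0..j. Poly_Mapping.lookup g i)" for j
  define \<beta> where "\<beta> i \<longleftrightarrow> Poly_Mapping.lookup x i = 1" for i
  have x01: "Poly_Mapping.lookup x i = of_bool (\<beta> i)" if "i \<in> {1..n}" for i
    using m that by (auto simp: \<beta>_def)
  have g0: "Poly_Mapping.lookup g 0 = 0"
  proof -
    have "l 0 * x_ext x 0 \<le> Poly_Mapping.lookup g 0" "Poly_Mapping.lookup g 0 \<le> u 0 * x_ext x 0"
      using m by auto
    then show ?thesis using l by simp
  qed
  have sn: "s n = d" using m by (simp add: s_def)
  have s0: "s 0 = 0" using g0 by (simp add: s_def)
  have diff: "s i - s (i - 1) = Poly_Mapping.lookup g i" if "i \<in> {1..n}" for i
    using that by (cases i) (auto simp: s_def)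
  have gi: "\<bar>Poly_Mapping.lookup g i\<bar> \<le> of_bool (\<beta> i) * u i" if i: "i \<in> {1..n}" for i
  proof -
    have "l i * x_ext x i \<le> Poly_Mapping.lookup g i" "Poly_Mapping.lookup g i \<le> u i * x_ext x i"
      using m i by auto
    then show ?thesis using x01[OF i] l(1)[OF i] i by (auto simp: x_ext_def abs_le_iff)
  qed
  have gi': "\<bar>Poly_Mapping.lookup g i\<bar> \<le> real \<kappa>bar * f" if i: "i \<in> {1..n}" for i
  proof -
    have "of_bool (\<beta> i) * u i \<le> real \<kappa>bar * f"
      using u[OF i] \<kappa>[OF i] f by (auto intro!: mult_right_mono)
    then show ?thesis using gi[OF i] by linarith
  qed
  have s_bound: "\<bar>s j\<bar> \<le> real (n * \<kappa>bar) * f" if j: "j \<le> n" for j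
  proof -
    have "\<bar>s j\<bar> \<le> real j * (real \<kappa>bar * f)" using j
    proof (induction j)
      case (Suc j)
      then show ?case using diff[of "Suc j"] gi'[of "Suc j"] by (auto simp: algebra_simps)
    qed (simp add: s0)
    also have "\<dots> \<le> real n * (real \<kappa>bar * f)" using j f by (intro mult_right_mono) auto
    finally show ?thesis by (simp add: mult.assoc)
  qed
  obtain \<Theta> w where \<Theta>: "finite \<Theta>" "\<Theta> \<subseteq> {0..<1}" "\<And>\<theta>. \<theta> \<in> \<Theta> \<Longrightarrow> 0 \<le> w \<theta>" "sum w \<Theta> = 1"
    and avg: "\<And>t. t \<in> s ` {0..n} \<Longrightarrow> (\<Sum>\<theta>\<in>\<Theta>. w \<theta> * stair f d \<theta> t) = t"
    using stair_average[OF d, of "s ` {0..n}"] by blast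
  define h where "h \<theta> = (\<Sum>i=1..n. Poly_Mapping.single i (stair f d \<theta> (s i) - stair f d \<theta> (s (i - 1))))" for \<theta>
  have look: "Poly_Mapping.lookup (h \<theta>) k =
      (if k \<in> {1..n} then stair f d \<theta> (s k) - stair f d \<theta> (s (k - 1)) else 0)" for \<theta> k
    unfolding h_def lookup_sum lookup_single by (simp add: when_def)
  have mem: "\<exists>y. path_flow n ?S u d (x, h \<theta>) y" if "\<theta> \<in> \<Theta>" for \<theta>
  proof (rule path_flow_of_path[where \<sigma> = "\<lambda>i. stair f d \<theta> (s i)" and \<beta> = \<beta>])
    have th: "0 \<le> \<theta>" "\<theta> < 1" using \<Theta> that by auto
    show "stair f d \<theta> (s 0) = 0" "stair f d \<theta> (s n) = d"
      using stair_fixes[OF d th] by (simp_all add: s0 sn)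
    show "stair f d \<theta> (s i) \<in> ?S" if "i \<le> n" for i
      by (rule stair_mem_grid[OF d th s_bound[OF that]])
    show "\<bar>stair f d \<theta> (s i) - stair f d \<theta> (s (i - 1))\<bar> \<le> of_bool (\<beta> i) * u i" if i: "i \<in> {1..n}" for i
    proof (cases "\<beta> i")
      case True
      then have "\<bar>s i - s (i - 1)\<bar> \<le> real (\<kappa> i) * f" using diff[OF i] gi[OF i] u[OF i] by simp
      then show ?thesis using stair_nonexpansive[OF d] True u[OF i] by simp
    next
      case False
      then have "s i = s (i - 1)" using diff[OF i] gi[OF i] by simp
      then show ?thesis using False by simp
    qed
    show "Poly_Mapping.lookup (fst (x, h \<theta>)) i = of_bool (\<beta> i)" if "i \<in> {1..n}" for i
      using x01[OF that] by simp
    show "Poly_Mapping.lookup (snd (x, h \<theta>)) i = stair f d \<theta> (s i) - stair f d \<theta> (s (i - 1))"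
      if "i \<in> {1..n}" for i
      using that by (simp add: look)
    show "Poly_Mapping.lookup (snd (x, h \<theta>)) 0 = 0" by (simp add: look)
  qed (rule finite_grid)
  have "z = (\<Sum>\<theta>\<in>\<Theta>. w \<theta> *\<^sub>R (x, h \<theta>))"
  proof (rule prod_eqI)
    show "fst z = fst (\<Sum>\<theta>\<in>\<Theta>. w \<theta> *\<^sub>R (x, h \<theta>))"
      using scaleR_sum_left[of w \<Theta> x] \<Theta>(4) by (simp add: xg fst_sum)
    show "snd z = snd (\<Sum>\<theta>\<in>\<Theta>. w \<theta> *\<^sub>R (x, h \<theta>))"
    proof (rule poly_mapping_eqI)
      fix k
      have "Poly_Mapping.lookup g k = (\<Sum>\<theta>\<in>\<Theta>. w \<theta> * Poly_Mapping.lookup (h \<theta>) k)"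
      proof (cases "k \<in> {1..n}")
        case True
        have "(\<Sum>\<theta>\<in>\<Theta>. w \<theta> * Poly_Mapping.lookup (h \<theta>) k) =
          (\<Sum>\<theta>\<in>\<Theta>. w \<theta> * stair f d \<theta> (s k)) - (\<Sum>\<theta>\<in>\<Theta>. w \<theta> * stair f d \<theta> (s (k - 1)))"
          using True by (simp add: look right_diff_distrib sum_subtractf)
        also have "\<dots> = s k - s (k - 1)"
        proof -
          have "s k \<in> s ` {0..n}" "s (k - 1) \<in> s ` {0..n}" using True by (auto intro!: imageI)
          then show ?thesis by (simp only: avg)
        qed
        finally show ?thesis using diff[OF True] by simp
      next
        case False
        have "Poly_Mapping.lookup g k = 0"
        proof (cases "k = 0")
          case neq: False
          then have "k \<notin> Poly_Mapping.keys g" using m False by auto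
          then show ?thesis by (simp add: in_keys_iff)
        qed (simp add: g0)
        moreover have "(\<Sum>\<theta>\<in>\<Theta>. w \<theta> * Poly_Mapping.lookup (h \<theta>) k) = 0"
          by (rule sum.neutral) (use False look in auto)
        ultimately show ?thesis by simp
      qed
      then show "Poly_Mapping.lookup (snd z) k = Poly_Mapping.lookup (snd (\<Sum>\<theta>\<in>\<Theta>. w \<theta> *\<^sub>R (x, h \<theta>))) k"
        by (simp add: xg snd_sum lookup_sum lookup_scaleR)
    qed
  qed
  also have "\<dots> \<in> {z. \<exists>y. path_flow n ?S u d z y}"
    by (rule convex_sum[OF \<Theta>(1) convex_path_flow \<Theta>(4)]) (use \<Theta> mem in auto)
  finally show ?thesis by simp
qed

lemma projection_path_flow:
  fixes n \<kappa>bar :: nat and f d :: real and \<kappa> :: "nat \<Rightarrow> nat"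
  assumes f: "0 < f" and d: "0 \<le> d" "d < f"
    and \<kappa>: "\<And>j. j \<in> {1..n} \<Longrightarrow> \<kappa> j \<le> \<kappa>bar"
    and u: "\<And>j. j \<in> {1..n} \<Longrightarrow> u j = real (\<kappa> j) * f"
    and l: "\<And>j. j \<in> {1..n} \<Longrightarrow> l j = - u j" "l 0 = 0" "u 0 = 0"
  shows "{z \<in> xf_space n. \<exists>y. path_flow n (grid f d (n * \<kappa>bar)) u d z y} = convex hull (flow_set n d l u)"
    (is "?P = _")
proof
  show "?P \<subseteq> convex hull (flow_set n d l u)"
  proof
    fix z assume "z \<in> ?P"
    then obtain y where "z \<in> xf_space n" "path_flow n (grid f d (n * \<kappa>bar)) u d z y" by blast
    then show "z \<in> convex hull (flow_set n d l u)"
      by (rule path_flow_imp_convex_hull[OF finite_grid zero_mem_grid d_mem_grid]) (use l in auto)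
  qed
  have "?P = xf_space n \<inter> {z. \<exists>y. path_flow n (grid f d (n * \<kappa>bar)) u d z y}" by blast
  then have "convex ?P" using convex_xf_space convex_path_flow by (simp add: convex_Int)
  moreover have "flow_set n d l u \<subseteq> ?P"
  proof
    fix z assume z: "z \<in> flow_set n d l u"
    then have "z \<in> xf_space n" by (auto simp: flow_set_def)
    moreover have "\<exists>y. path_flow n (grid f d (n * \<kappa>bar)) u d z y"
      by (rule rounded_flow_average[where \<kappa> = \<kappa> and l = l]) (use assms z in auto)
    ultimately show "z \<in> ?P" by blast
  qed
  ultimately show "convex hull (flow_set n d l u) \<subseteq> ?P" by (rule hull_minimal[rotated])
qed

section \<open>The linear system and its size\<close>

lemma path_flow_encoding:
  assumes S: "finite S"
  shows "\<exists>m cs.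
    (\<forall>z. (\<exists>Y. \<forall>c\<in>set cs. satisfies n m z Y c) \<longleftrightarrow> (\<exists>y. path_flow n S u d z y)) \<and>
    formulation_size n m cs = 4 * n + 2 + 2 * card (network n S u) + (n + 1) * card S"
proof -
  let ?I = "network n S u"
  define m where "m = card ?I"
  \<comment> \<open>The numbering \<open>h\<close> of the arcs turns arc variables into the variables \<open>Y 0, \<dots>, Y (m - 1)\<close>.\<close>
  obtain h where h: "bij_betw h {..<m} ?I"
    using ex_bij_betw_nat_finite[OF finite_network[OF S]] unfolding m_def atLeast0LessThan by blast
  obtain sl where sl: "set sl = S" "distinct sl" using finite_distinct_list[OF S] by blast
  define nonneg where
    "nonneg = map (\<lambda>k. Lin_Le (\<lambda>_. 0) (\<lambda>_. 0) (\<lambda>k'. - of_bool (k' = k)) 0) [0..<m]"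
  define bal where
    "bal = map (\<lambda>(j, s). Lin_Eq (\<lambda>_. 0) (\<lambda>_. 0) (\<lambda>k. balance_coeff j s (h k))
             (of_bool (j = n \<and> s = d) - of_bool (j = 0 \<and> s = 0))) (List.product [0..<Suc n] sl)"
  define linkx where
    "linkx = map (\<lambda>j. Lin_Eq (\<lambda>i. of_bool (i = j)) (\<lambda>_. 0) (\<lambda>k. - x_coeff j (h k)) 0) [1..<Suc n]"
  define linkf where
    "linkf = map (\<lambda>j. Lin_Eq (\<lambda>_. 0) (\<lambda>i. of_bool (i = j)) (\<lambda>k. - f_coeff j (h k)) 0) [0..<Suc n]"
  define cs where "cs = nonneg @ bal @ linkx @ linkf"
  have reindex: "(\<Sum>k<m. g (h k) * y (h k)) = (\<Sum>a\<in>?I. g a * y a)" for g y :: "arc \<Rightarrow> real"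
    by (rule sum.reindex_bij_betw[OF h])
  have pick: "(\<Sum>i=p..n. of_bool (i = j) * (g i :: real)) = g j" if "j \<in> {p..n}" for g :: "nat \<Rightarrow> real" and j p
    using that by (simp add: of_bool_def if_distrib[of "\<lambda>c. c * _"] cong: if_cong)
  have pick': "(\<Sum>i<m. of_bool (i = j) * (g i :: real)) = g j" if "j < m" for g :: "nat \<Rightarrow> real" and j
    using that by (simp add: of_bool_def if_distrib[of "\<lambda>c. c * _"] cong: if_cong)
  have sat: "(\<forall>c\<in>set cs. satisfies n m z Y c) \<longleftrightarrow> path_flow n S u d z y"
    if Y: "\<And>k. k < m \<Longrightarrow> Y k = y (h k)" for z Y y
  proof -
    have Ysum: "(\<Sum>k<m. g (h k) * Y k) = (\<Sum>a\<in>?I. g a * y a)" for g :: "arc \<Rightarrow> real"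
      unfolding reindex[symmetric] by (rule sum.cong) (auto simp: Y)
    have "(\<forall>c\<in>set nonneg. satisfies n m z Y c) \<longleftrightarrow> (\<forall>k<m. 0 \<le> Y k)"
      by (auto simp: nonneg_def linear_form_def sum_negf pick')
    also have "\<dots> \<longleftrightarrow> (\<forall>a\<in>h ` {..<m}. 0 \<le> y a)" by (auto simp: Y)
    also have "h ` {..<m} = ?I" using h by (simp add: bij_betw_def)
    finally have 1: "(\<forall>c\<in>set nonneg. satisfies n m z Y c) \<longleftrightarrow> (\<forall>a\<in>?I. 0 \<le> y a)" .
    have "set bal = (\<lambda>(j, s). Lin_Eq (\<lambda>_. 0) (\<lambda>_. 0) (\<lambda>k. balance_coeff j s (h k))
        (of_bool (j = n \<and> s = d) - of_bool (j = 0 \<and> s = 0))) ` ({0..n} \<times> S)"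
      by (simp add: bal_def sl atLeastLessThanSuc_atLeastAtMost del: upt_Suc)
    moreover have "satisfies n m z Y (Lin_Eq (\<lambda>_. 0) (\<lambda>_. 0) (\<lambda>k. balance_coeff j s (h k)) r) \<longleftrightarrow>
        (\<Sum>a\<in>?I. balance_coeff j s a * y a) = r" for j s r
      by (simp add: linear_form_def Ysum)
    ultimately have 2: "(\<forall>c\<in>set bal. satisfies n m z Y c) \<longleftrightarrow>
      (\<forall>j\<in>{0..n}. \<forall>s\<in>S. (\<Sum>a\<in>?I. balance_coeff j s a * y a) =
        of_bool (j = n \<and> s = d) - of_bool (j = 0 \<and> s = 0))"
      by (simp only: ball_simps) simp
    have "set linkx = (\<lambda>j. Lin_Eq (\<lambda>i. of_bool (i = j)) (\<lambda>_. 0) (\<lambda>k. - x_coeff j (h k)) 0) ` {1..n}"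
      by (simp add: linkx_def atLeastLessThanSuc_atLeastAtMost del: upt_Suc)
    moreover have "satisfies n m z Y (Lin_Eq (\<lambda>i. of_bool (i = j)) (\<lambda>_. 0) (\<lambda>k. - x_coeff j (h k)) 0) \<longleftrightarrow>
        Poly_Mapping.lookup (fst z) j = (\<Sum>a\<in>?I. x_coeff j a * y a)" if "j \<in> {1..n}" for j
      unfolding satisfies.simps linear_form_def pick[OF that] mult_minus_left sum_negf Ysum by simp
    ultimately have 3: "(\<forall>c\<in>set linkx. satisfies n m z Y c) \<longleftrightarrow>
      (\<forall>j\<in>{1..n}. Poly_Mapping.lookup (fst z) j = (\<Sum>a\<in>?I. x_coeff j a * y a))"
      by (simp only: ball_simps(9) cong: ball_cong)
    have "set linkf = (\<lambda>j. Lin_Eq (\<lambda>_. 0) (\<lambda>i. of_bool (i = j)) (\<lambda>k. - f_coeff j (h k)) 0) ` {0..n}"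
      by (simp add: linkf_def atLeastLessThanSuc_atLeastAtMost del: upt_Suc)
    moreover have "satisfies n m z Y (Lin_Eq (\<lambda>_. 0) (\<lambda>i. of_bool (i = j)) (\<lambda>k. - f_coeff j (h k)) 0) \<longleftrightarrow>
        Poly_Mapping.lookup (snd z) j = (\<Sum>a\<in>?I. f_coeff j a * y a)" if "j \<in> {0..n}" for j
      unfolding satisfies.simps linear_form_def pick[OF that] mult_minus_left sum_negf Ysum by simp
    ultimately have 4: "(\<forall>c\<in>set linkf. satisfies n m z Y c) \<longleftrightarrow>
      (\<forall>j\<in>{0..n}. Poly_Mapping.lookup (snd z) j = (\<Sum>a\<in>?I. f_coeff j a * y a))"
      by (simp only: ball_simps(9) cong: ball_cong)
    have "(\<forall>c\<in>set cs. satisfies n m z Y c) \<longleftrightarrow>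
      (\<forall>c\<in>set nonneg. satisfies n m z Y c) \<and> (\<forall>c\<in>set bal. satisfies n m z Y c) \<and>
      (\<forall>c\<in>set linkx. satisfies n m z Y c) \<and> (\<forall>c\<in>set linkf. satisfies n m z Y c)"
      unfolding cs_def by auto
    then show ?thesis unfolding path_flow_def 1 2 3 4 .
  qed
  show ?thesis
  proof (intro exI conjI allI)
    fix z
    show "(\<exists>Y. \<forall>c\<in>set cs. satisfies n m z Y c) \<longleftrightarrow> (\<exists>y. path_flow n S u d z y)"
    proof
      assume "\<exists>Y. \<forall>c\<in>set cs. satisfies n m z Y c"
      then obtain Y where Y: "\<forall>c\<in>set cs. satisfies n m z Y c" by blast
      have "Y k = (Y \<circ> inv_into {..<m} h) (h k)" if "k < m" for k
        using h that by (simp add: bij_betw_def)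
      from sat[where Y = Y and y = "Y \<circ> inv_into {..<m} h", OF this] Y show "\<exists>y. path_flow n S u d z y" by blast
    next
      assume "\<exists>y. path_flow n S u d z y"
      then obtain y where "path_flow n S u d z y" by blast
      moreover have "(\<forall>c\<in>set cs. satisfies n m z (y \<circ> h) c) \<longleftrightarrow> path_flow n S u d z y"
        by (rule sat) simp
      ultimately show "\<exists>Y. \<forall>c\<in>set cs. satisfies n m z Y c" by blast
    qed
    have "length cs = m + (n + 1) * card S + n + (n + 1)"
      using sl distinct_card[OF sl(2)] by (simp add: cs_def nonneg_def bal_def linkx_def linkf_def length_product)
    then show "formulation_size n m cs = 4 * n + 2 + 2 * card ?I + (n + 1) * card S"
      by (simp add: formulation_size_def m_def)
  qed
qed

text \<open>
  The outer variable \<open>a\<close> is \<open>n\<close>, the variable \<open>b\<close> of the coefficients is the bound on the \<open>\<kappa>\<^sub>j\<close>, and \<open>g\<close> bounds the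
  number of grid points that partial sums can reach.
\<close>

definition size_poly :: "nat poly poly" where
  "size_poly = (let a = [:0, 1:]; b = [:[:0, 1:]:]; g = 4 * (a * b) + 2
     in 4 * a + 2 + 4 * a * g ^ 2 + (a + 1) * g)"

lemma poly_eval2_size_poly:
  "poly_eval2 size_poly n k =
     4 * n + 2 + 4 * n * (4 * (n * k) + 2) ^ 2 + (n + 1) * (4 * (n * k) + 2)"
  unfolding poly_eval2_def size_poly_def Let_def poly_add poly_mult poly_power
  by simp

theorem proposition4:
  shows "\<exists>p :: nat poly poly.
    \<forall>(n :: nat) (\<kappa>bar :: nat) (fbar :: real) (d :: real) (\<kappa> :: nat \<Rightarrow> nat)
      (l :: nat \<Rightarrow> real) (u :: nat \<Rightarrow> real).
      1 \<le> \<kappa>bar \<longrightarrow>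
      0 < fbar \<longrightarrow>
      d \<in> {0..<fbar} \<longrightarrow>
      (\<forall>j\<in>{1..n}. \<kappa> j \<in> {1..\<kappa>bar}) \<longrightarrow>
      (\<forall>j\<in>{1..n}. u j = real (\<kappa> j) * fbar) \<longrightarrow>
      (\<forall>j\<in>{1..n}. l j = - u j) \<longrightarrow>
      l 0 = 0 \<longrightarrow>
      u 0 = 0 \<longrightarrow>
      (\<exists>(m :: nat) (cs :: linear_constraint list).
         extended_formulation n m cs (convex hull (flow_set n d l u)) \<and>
         formulation_size n m cs \<le> poly_eval2 p n \<kappa>bar)"
proof (rule exI[of _ size_poly], intro allI impI)
  fix n \<kappa>bar :: nat and f d :: real and \<kappa> :: "nat \<Rightarrow> nat" and l u :: "nat \<Rightarrow> real"
  assume asm: "1 \<le> \<kappa>bar" "0 < f" "d \<in> {0..<f}" "\<forall>j\<in>{1..n}. \<kappa> j \<in> {1..\<kappa>bar}"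
    "\<forall>j\<in>{1..n}. u j = real (\<kappa> j) * f" "\<forall>j\<in>{1..n}. l j = - u j" "l 0 = 0" "u 0 = 0"
  let ?S = "grid f d (n * \<kappa>bar)"
  obtain m cs where enc:
      "\<forall>z. (\<exists>Y. \<forall>c\<in>set cs. satisfies n m z Y c) \<longleftrightarrow> (\<exists>y. path_flow n ?S u d z y)"
    and size: "formulation_size n m cs = 4 * n + 2 + 2 * card (network n ?S u) + (n + 1) * card ?S"
    using path_flow_encoding[where S = ?S and n = n and u = u and d = d, OF finite_grid] by metis
  have "extended_formulation n m cs (convex hull (flow_set n d l u))"
    unfolding extended_formulation_def enc[rule_format]
    by (rule projection_path_flow[where \<kappa> = \<kappa>]) (use asm in auto)
  moreover have "formulation_size n m cs \<le> poly_eval2 size_poly n \<kappa>bar"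
  proof -
    have S: "card ?S \<le> 4 * (n * \<kappa>bar) + 2" by (rule card_grid)
    have "card (network n ?S u) \<le> n * (2 * card ?S ^ 2)" by (rule card_network[OF finite_grid])
    also have "\<dots> \<le> n * (2 * (4 * (n * \<kappa>bar) + 2) ^ 2)" using S by (intro mult_le_mono power_mono) auto
    finally have "2 * card (network n ?S u) \<le> 4 * n * (4 * (n * \<kappa>bar) + 2) ^ 2" by linarith
    moreover have "(n + 1) * card ?S \<le> (n + 1) * (4 * (n * \<kappa>bar) + 2)" using S by (rule mult_le_mono2)
    ultimately show ?thesis unfolding size poly_eval2_size_poly by linarith
  qed
  ultimately show "\<exists>m cs. extended_formulation n m cs (convex hull (flow_set n d l u)) \<and>
      formulation_size n m cs \<le> poly_eval2 size_poly n \<kappa>bar" by blast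
qed

end
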